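(* There exists an absolute constant $C>0$ such that the following holds. Let $T>0$ and suppose that the functions $f^{11},f^{12},f^{21},f^{22},G^1,G^2$ of $(t,x)$, $t\in[0,T]$, $x\in\mathbb{R}$, satisfy $$\partial_t f^{11}+\partial_x f^{12}=G^1,\qquad \partial_t f^{21}-\partial_x f^{22}=G^2,$$ and that $f^{11},f^{12},f^{21},f^{22}\to 0$ as $|x|\to\infty$. Then $$\begin{aligned} \int_0^T\!\!\int_{-\infty}^{+\infty}\left(f^{11}f^{22}+f^{12}f^{21}\right)dx\,dt\ \leq\ C&\left(\|f^{11}(0)\|_{L^1}+\sup_{0\leq t\leq T}\|f^{11}(t)\|_{L^1}+\int_0^T\!\!\int_{-\infty}^{+\infty}|G^1|\,dx\,dt\right)\\ &\cdot\left(\|f^{21}(0)\|_{L^1}+\sup_{0\leq t\leq T}\|f^{21}(t)\|_{L^1}+\int_0^T\!\!\int_{-\infty}^{+\infty}|G^2|\,dx\,dt\right), \end{aligned}$$ provided that the right-hand side is bounded.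
   Context: $f(t)$ denotes the function $x\mapsto f(t,x)$, and $\|f(t)\|_{L^1}=\int_{-\infty}^{+\infty}|f(t,x)|\,dx$.
   Formalization: The decay of the f's as |x|→∞ is taken uniformly in t∈[0,T] (with decay only for each fixed t the claim fails: a bump may sweep across the line N times), and the equations are read classically, with the f's and the partial derivatives that occur continuous on [0,T]×R. *)

theory Defs
  imports "HOL-Analysis.Analysis"
begin

text \<open>
  Functions of \<open>(t, x)\<close> with \<open>t \<in> [0, T]\<close> are curried total functions \<open>real \<Rightarrow> real \<Rightarrow> real\<close>;
  their values for \<open>t \<notin> [0, T]\<close> never matter. In particular the time derivative is taken
  within \<open>[0, T]\<close>, so it is one-sided at \<open>t = 0\<close> and \<open>t = T\<close>.
\<close>

definition pd_t :: "real \<Rightarrow> (real \<Rightarrow> real \<Rightarrow> real) \<Rightarrow> real \<Rightarrow> real \<Rightarrow> real" where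
  "pd_t T f t x = vector_derivative (\<lambda>s. f s x) (at t within {0..T})"

definition pd_x :: "(real \<Rightarrow> real \<Rightarrow> real) \<Rightarrow> real \<Rightarrow> real \<Rightarrow> real" where
  "pd_x f t x = deriv (f t) x"

definition cont_strip :: "real \<Rightarrow> (real \<Rightarrow> real \<Rightarrow> real) \<Rightarrow> bool" where
  "cont_strip T f \<longleftrightarrow> continuous_on ({0..T} \<times> UNIV) (\<lambda>(t, x). f t x)"

text \<open>
  The differential equations are understood classically: each unknown is continuous on the strip
  and the one partial derivative of it that occurs in the system exists and is continuous there.
  This holds in particular if all unknowns are \<open>C\<^sup>1\<close>.
\<close>

definition C1_in_t :: "real \<Rightarrow> (real \<Rightarrow> real \<Rightarrow> real) \<Rightarrow> bool" where
  "C1_in_t T f \<longleftrightarrow> cont_strip T f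
     \<and> (\<forall>t\<in>{0..T}. \<forall>x. (\<lambda>s. f s x) differentiable (at t within {0..T}))
     \<and> cont_strip T (pd_t T f)"

definition C1_in_x :: "real \<Rightarrow> (real \<Rightarrow> real \<Rightarrow> real) \<Rightarrow> bool" where
  "C1_in_x T f \<longleftrightarrow> cont_strip T f
     \<and> (\<forall>t\<in>{0..T}. \<forall>x. f t differentiable (at x))
     \<and> cont_strip T (pd_x f)"

text \<open>
  Decay as \<open>\<bar>x\<bar> \<rightarrow> \<infinity>\<close> is uniform in \<open>t \<in> [0, T]\<close>. Decay for each fixed \<open>t\<close> would not be enough
  for the estimate: a bump \<open>f\<^sup>1\<^sup>1\<close> with flux \<open>f\<^sup>1\<^sup>2\<close> could run from \<open>-\<infinity>\<close> to \<open>\<infinity>\<close> in finite time,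
  re-enter from \<open>-\<infinity>\<close>, and so cross a stationary bump \<open>f\<^sup>2\<^sup>1\<close> arbitrarily often.
\<close>

definition vanishes_at_infinity :: "real \<Rightarrow> (real \<Rightarrow> real \<Rightarrow> real) \<Rightarrow> bool" where
  "vanishes_at_infinity T f \<longleftrightarrow> uniform_limit {0..T} (\<lambda>x t. f t x) (\<lambda>t. 0) at_infinity"

text \<open>
  Norms take values in \<open>[0, \<infinity>]\<close>, so that finiteness is a condition rather than built in.
\<close>

definition L1_norm :: "(real \<Rightarrow> real) \<Rightarrow> ennreal" where
  "L1_norm g = (\<integral>\<^sup>+x. ennreal \<bar>g x\<bar> \<partial>lborel)"

definition data_size :: "real \<Rightarrow> (real \<Rightarrow> real \<Rightarrow> real) \<Rightarrow> (real \<Rightarrow> real \<Rightarrow> real) \<Rightarrow> ennreal" where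
  "data_size T f G =
     L1_norm (f 0) + (SUP t\<in>{0..T}. L1_norm (f t))
       + (\<integral>\<^sup>+t\<in>{0..T}. (\<integral>\<^sup>+x. ennreal \<bar>G t x\<bar> \<partial>lborel) \<partial>lborel)"

end

theory Submission
  imports Defs
begin

text \<open>
  The constant is \<open>C = 1\<close>. Think of \<open>f11\<close> as a density that moves to the right with flux \<open>f12\<close>,
  and of \<open>f21\<close> as one that moves to the left with flux \<open>f22\<close>. The interaction functional
  \<open>I(t) = \<integral>\<integral> f11(t,x) f21(t,y) dx dy\<close>, taken over \<open>x < y\<close>, measures how much of the two
  densities has yet to cross. Formally, inserting the equations and integrating by parts gives

  \<open>I'(t) = - \<integral> (f11 f22 + f12 f21) dx + \<integral>\<integral> (G1(t,x) f21(t,y) + f11(t,x) G2(t,y)) dx dy\<close>,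

  the second integral again over \<open>x < y\<close>. So the left-hand side of the estimate is
  \<open>I(0) - I(T)\<close> plus the time integral of the source terms. Each double integral is at most the
  product of the \<open>L\<^sup>1\<close> norms of its two factors, and after integration in time all the products
  that occur are found among those of the multiplied-out right-hand side.

  The time derivatives of the densities need not be integrable over the line, so this
  computation is carried out on \<open>[0, T] \<times> [a, b]\<close>, where everything is continuous. With
  \<open>F t x = integral {a..x} (f11 t)\<close> the functional there is the integral of \<open>F t x * f21 t x\<close> over
  \<open>x\<close>. The balance of the terms at a fixed time is \<open>interaction_estimate_fixed_time\<close>, the
  integration in time is \<open>integral_time_derivative_of_interaction\<close>, and together they give
  \<open>interaction_estimate_rectangle\<close>. The truncation costs only the values of \<open>f12\<close> at \<open>a\<close> and of
  \<open>f22\<close> at \<open>b\<close>, multiplied by norms of the densities; since the decay is uniform in time, these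
  terms disappear as the rectangle grows. The integrals over the rectangles converge to the one
  over the strip by \<open>tendsto_integral_strip\<close>, since the integrand is integrable: in
  each of its two products the density is integrable and the flux is bounded.
\<close>

section \<open>The interaction functional on a rectangle\<close>

lemma continuous_on_indefinite_integral:
  fixes f :: "real \<Rightarrow> real"
  assumes "continuous_on {a..b} f"
  shows "continuous_on {a..b} (\<lambda>x. integral {a..x} f)"
  using integral_has_vector_derivative[OF assms]
  by (rule continuous_on_vector_derivative)

lemma abs_indefinite_integral_le:
  fixes f :: "real \<Rightarrow> real"
  assumes f: "continuous_on {a..b} f" and x: "x \<in> {a..b}"
  shows "\<bar>integral {a..x} f\<bar> \<le> integral {a..b} (\<lambda>y. \<bar>f y\<bar>)"
proof -
  have fx: "continuous_on {a..x} f"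
    using x by (intro continuous_on_subset[OF f]) auto
  have "\<bar>integral {a..x} f\<bar> \<le> integral {a..x} (\<lambda>y. \<bar>f y\<bar>)"
    using integral_norm_bound_integral[of f "{a..x}" "\<lambda>y. \<bar>f y\<bar>"]
    by (auto intro!: integrable_continuous_real continuous_intros fx)
  also have "\<dots> \<le> integral {a..b} (\<lambda>y. \<bar>f y\<bar>)"
    using x by (intro integral_subset_le integrable_continuous_real continuous_intros fx f) auto
  finally show ?thesis .
qed

text \<open>
  This is the spatial half of the balance law for the interaction functional, at one instant:
  \<open>f11t\<close> and \<open>f21t\<close> stand for the time derivatives, so that the second integral is
  the time derivative of \<open>\<integral> F f21 dx\<close> with \<open>F x = integral {a..x} f11\<close>. The first
  equation, integrated from \<open>a\<close> to \<open>x\<close>, turns the time derivative of \<open>F\<close> into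
  \<open>- f12\<close> and so produces the term \<open>- f12 f21\<close>; the second one turns \<open>f21t\<close> into
  \<open>f22x\<close>, and integration by parts then produces \<open>- f11 f22\<close>. What is left are the
  sources and one boundary term at each end of the interval.
\<close>

lemma interaction_estimate_fixed_time:
  fixes f11 f12 f21 f22 G1 G2 f11t f21t f12x f22x :: "real \<Rightarrow> real"
  assumes ab: "a \<le> b"
    and cont: "continuous_on {a..b} f11" "continuous_on {a..b} f21"
      "continuous_on {a..b} G1" "continuous_on {a..b} G2"
      "continuous_on {a..b} f11t" "continuous_on {a..b} f21t"
    and f12x: "\<And>x. x \<in> {a..b} \<Longrightarrow> (f12 has_real_derivative f12x x) (at x)"
    and f22x: "\<And>x. x \<in> {a..b} \<Longrightarrow> (f22 has_real_derivative f22x x) (at x)"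
    and eq1: "\<And>x. x \<in> {a..b} \<Longrightarrow> f11t x + f12x x = G1 x"
    and eq2: "\<And>x. x \<in> {a..b} \<Longrightarrow> f21t x - f22x x = G2 x"
  defines "N \<equiv> \<lambda>f. integral {a..b} (\<lambda>x. \<bar>f x\<bar>)"
  shows "integral {a..b} (\<lambda>x. f11 x * f22 x + f12 x * f21 x)
         + integral {a..b} (\<lambda>x. integral {a..x} f11t * f21 x + integral {a..x} f11 * f21t x)
       \<le> N G1 * N f21 + N f11 * N G2 + \<bar>f12 a\<bar> * N f21 + N f11 * \<bar>f22 b\<bar>"
proof -
  define F where "F x = integral {a..x} f11" for x
  define g where "g x = integral {a..x} G1" for x
  have [continuous_intros]: "continuous_on {a..b} f12" "continuous_on {a..b} f22"
    by (rule DERIV_continuous_on[OF has_field_derivative_at_within], erule f12x f22x)+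
  have [continuous_intros]: "continuous_on {a..b} f22x"
  proof (rule continuous_on_eq)
    show "continuous_on {a..b} (\<lambda>x. f21t x - G2 x)"
      by (intro continuous_intros cont)
  qed (simp flip: eq2)
  have [continuous_intros]: "continuous_on {a..b} F" "continuous_on {a..b} g"
    "continuous_on {a..b} (\<lambda>x. integral {a..x} f11t)"
    unfolding F_def g_def by (intro continuous_on_indefinite_integral cont)+
  note [continuous_intros] = cont
  \<comment> \<open>The time derivative of \<open>F\<close>, by the first equation.\<close>
  have W: "integral {a..x} f11t = g x - f12 x + f12 a" if x: "x \<in> {a..b}" for x
  proof -
    have "(f12x has_integral (f12 x - f12 a)) {a..x}"
      using x by (intro fundamental_theorem_of_calculus)
        (auto simp flip: has_real_derivative_iff_has_vector_derivative
              intro!: has_field_derivative_at_within[OF f12x])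
    moreover have "(G1 has_integral g x) {a..x}"
      unfolding g_def using x
      by (intro integrable_integral integrable_continuous_real continuous_on_subset[OF cont(3)]) auto
    ultimately have "((\<lambda>y. G1 y - f12x y) has_integral (g x - (f12 x - f12 a))) {a..x}"
      by (intro has_integral_diff)
    then have "(f11t has_integral (g x - (f12 x - f12 a))) {a..x}"
      by (rule has_integral_eq[rotated]) (use x in \<open>simp flip: eq1\<close>)
    then show ?thesis by (simp add: integral_unique)
  qed
  have F': "(F has_real_derivative f11 x) (at x within {a..b})" if "x \<in> {a..b}" for x
    unfolding F_def using integral_has_real_derivative[OF cont(1) that] .
  have "((\<lambda>x. f11 x * f22 x + F x * f22x x) has_integral (F b * f22 b - F a * f22 a)) {a..b}"
    using ab by (intro fundamental_theorem_of_calculus)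
      (auto simp flip: has_real_derivative_iff_has_vector_derivative
            intro!: derivative_eq_intros F' has_field_derivative_at_within[OF f22x])
  then have parts: "((\<lambda>x. f11 x * f22 x + F x * f22x x) has_integral F b * f22 b) {a..b}"
    by (simp add: F_def)
  have absF: "\<bar>F x\<bar> \<le> N f11" "\<bar>g x\<bar> \<le> N G1" if "x \<in> {a..b}" for x
    unfolding F_def g_def N_def using abs_indefinite_integral_le that cont by blast+
  have "integral {a..b} (\<lambda>x. f11 x * f22 x + f12 x * f21 x)
         + integral {a..b} (\<lambda>x. integral {a..x} f11t * f21 x + F x * f21t x)
      = integral {a..b} (\<lambda>x. (f11 x * f22 x + f12 x * f21 x)
         + (integral {a..x} f11t * f21 x + F x * f21t x))"
    by (intro Henstock_Kurzweil_Integration.integral_add[symmetric]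
        integrable_continuous_real continuous_intros)
  also have "\<dots> = integral {a..b} (\<lambda>x. (f11 x * f22 x + F x * f22x x)
         + ((g x + f12 a) * f21 x + F x * G2 x))"
    by (rule integral_cong) (simp add: W flip: eq2, simp add: algebra_simps)
  also have "\<dots> = F b * f22 b + integral {a..b} (\<lambda>x. (g x + f12 a) * f21 x + F x * G2 x)"
    by (subst Henstock_Kurzweil_Integration.integral_add)
       (auto simp: integral_unique[OF parts] intro!: integrable_continuous_real continuous_intros)
  also have "\<dots> \<le> N f11 * \<bar>f22 b\<bar>
      + integral {a..b} (\<lambda>x. (N G1 + \<bar>f12 a\<bar>) * \<bar>f21 x\<bar> + N f11 * \<bar>G2 x\<bar>)"
  proof (rule add_mono)
    show "F b * f22 b \<le> N f11 * \<bar>f22 b\<bar>"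
      using mult_right_mono[OF absF(1)[of b], of "\<bar>f22 b\<bar>"] ab
      by (simp flip: abs_mult)
    show "integral {a..b} (\<lambda>x. (g x + f12 a) * f21 x + F x * G2 x)
        \<le> integral {a..b} (\<lambda>x. (N G1 + \<bar>f12 a\<bar>) * \<bar>f21 x\<bar> + N f11 * \<bar>G2 x\<bar>)"
    proof (intro integral_le integrable_continuous_real continuous_intros add_mono)
      fix x assume x: "x \<in> {a..b}"
      have "(g x + f12 a) * f21 x \<le> \<bar>g x + f12 a\<bar> * \<bar>f21 x\<bar>"
        by (simp flip: abs_mult)
      also have "\<dots> \<le> (N G1 + \<bar>f12 a\<bar>) * \<bar>f21 x\<bar>"
        using absF(2)[OF x] by (intro mult_right_mono) auto
      finally show "(g x + f12 a) * f21 x \<le> (N G1 + \<bar>f12 a\<bar>) * \<bar>f21 x\<bar>" .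
      have "F x * G2 x \<le> \<bar>F x\<bar> * \<bar>G2 x\<bar>" by (simp flip: abs_mult)
      also have "\<dots> \<le> N f11 * \<bar>G2 x\<bar>"
        using absF(1)[OF x] by (intro mult_right_mono) auto
      finally show "F x * G2 x \<le> N f11 * \<bar>G2 x\<bar>" .
    qed
  qed
  also have "integral {a..b} (\<lambda>x. (N G1 + \<bar>f12 a\<bar>) * \<bar>f21 x\<bar> + N f11 * \<bar>G2 x\<bar>)
      = (N G1 + \<bar>f12 a\<bar>) * N f21 + N f11 * N G2"
    unfolding N_def
    by (subst Henstock_Kurzweil_Integration.integral_add)
       (auto intro!: integrable_continuous_real continuous_intros)
  finally show ?thesis by (simp add: F_def algebra_simps)
qed

lemma continuous_on_slice:
  assumes h: "continuous_on (S \<times> A) (\<lambda>(t, x). h t x)" and t: "t \<in> S"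
  shows "continuous_on A (h t)"
proof -
  have "continuous_on A (\<lambda>x. (t, x))" "(\<lambda>x. (t, x)) ` A \<subseteq> S \<times> A"
    using t by (auto intro!: continuous_intros)
  from continuous_on_compose2[OF h this] show ?thesis by simp
qed

text \<open>
  Mapping \<open>{a..x}\<close> affinely onto \<open>{0..1}\<close> makes the domain of integration independent of
  \<open>x\<close>, which reduces the claim to integrals with a continuous parameter.
\<close>

lemma continuous_on_indefinite_integral_param:
  fixes h :: "real \<Rightarrow> real \<Rightarrow> real"
  assumes h: "continuous_on (S \<times> {a..b}) (\<lambda>(t, x). h t x)"
  shows "continuous_on (S \<times> {a..b}) (\<lambda>(t, x). integral {a..x} (h t))"
proof (rule continuous_on_eq)
  have "continuous_on ((S \<times> {a..b}) \<times> cbox 0 1)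
     (\<lambda>(z, s). (snd z - a) * h (fst z) (a + s * (snd z - a)))"
  proof -
    have "a + s * (x - a) \<in> {a..b}" if "x \<in> {a..b}" "s \<in> {0..1}" for x s :: real
      using that mult_left_le_one_le[of "x - a" s] mult_nonneg_nonneg[of s "x - a"] by auto
    then have "continuous_on ((S \<times> {a..b}) \<times> {0..1})
        (\<lambda>z. (\<lambda>(t, x). h t x) (fst (fst z), a + snd z * (snd (fst z) - a)))"
      by (intro continuous_on_compose2[OF h] continuous_intros) auto
    then show ?thesis
      by (auto simp: case_prod_beta intro!: continuous_intros)
  qed
  from integral_continuous_on_param[OF this]
  show "continuous_on (S \<times> {a..b})
     (\<lambda>z. integral {0..1} (\<lambda>s. (snd z - a) * h (fst z) (a + s * (snd z - a))))"
    by simp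
next
  fix z assume z: "z \<in> S \<times> {a..b}"
  obtain t x where [simp]: "z = (t, x)" by force
  have "continuous_on {a..b} (h t)"
    using continuous_on_slice[OF h] z by auto
  then have "continuous_on {a..x} (h t)"
    by (rule continuous_on_subset) (use z in auto)
  then have "((\<lambda>s. (x - a) *\<^sub>R h t (a + s * (x - a))) has_integral
      integral {a + 0 * (x - a)..a + 1 * (x - a)} (h t)) {0..1}"
    using z mult_left_le_one_le[of "x - a"] mult_nonneg_nonneg[of _ "x - a"]
    by (intro has_integral_substitution[where c = a and d = x])
       (force intro!: derivative_eq_intros)+
  then show "integral {0..1} (\<lambda>s. (snd z - a) * h (fst z) (a + s * (snd z - a))) =
      (\<lambda>(t, x). integral {a..x} (h t)) z"
    by (auto simp del: integral_mult_right dest!: integral_unique)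
qed

text \<open>
  The temporal half of the balance law: differentiation under the integral sign gives the time
  derivative of \<open>F t x\<close>, and after exchanging the order of integration the fundamental
  theorem of calculus applies for each fixed \<open>x\<close>.
\<close>

lemma integral_time_derivative_of_interaction:
  fixes f11 f21 f11t f21t :: "real \<Rightarrow> real \<Rightarrow> real"
  assumes T: "0 \<le> T"
    and cont: "continuous_on ({0..T} \<times> {a..b}) (\<lambda>(t, x). f11 t x)"
      "continuous_on ({0..T} \<times> {a..b}) (\<lambda>(t, x). f21 t x)"
      "continuous_on ({0..T} \<times> {a..b}) (\<lambda>(t, x). f11t t x)"
      "continuous_on ({0..T} \<times> {a..b}) (\<lambda>(t, x). f21t t x)"
    and f11t: "\<And>t x. t \<in> {0..T} \<Longrightarrow> x \<in> {a..b} \<Longrightarrow>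
      ((\<lambda>s. f11 s x) has_vector_derivative f11t t x) (at t within {0..T})"
    and f21t: "\<And>t x. t \<in> {0..T} \<Longrightarrow> x \<in> {a..b} \<Longrightarrow>
      ((\<lambda>s. f21 s x) has_vector_derivative f21t t x) (at t within {0..T})"
  defines "F \<equiv> \<lambda>t x. integral {a..x} (f11 t)"
  shows "integral {0..T} (\<lambda>t. integral {a..b}
            (\<lambda>x. integral {a..x} (f11t t) * f21 t x + F t x * f21t t x))
       = integral {a..b} (\<lambda>x. F T x * f21 T x) - integral {a..b} (\<lambda>x. F 0 x * f21 0 x)"
proof -
  let ?d = "\<lambda>t x. integral {a..x} (f11t t) * f21 t x + F t x * f21t t x"
  note cF = continuous_on_indefinite_integral_param[OF cont(1), folded F_def]
  note cFt = continuous_on_indefinite_integral_param[OF cont(3)]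
  have "continuous_on ({0..T} \<times> {a..b}) (\<lambda>z. integral {a..snd z} (f11t (fst z)) * f21 (fst z) (snd z)
      + F (fst z) (snd z) * f21t (fst z) (snd z))"
    using cF cFt cont unfolding case_prod_beta by (intro continuous_intros)
  then have "continuous_on (cbox (0, a) (T, b)) (\<lambda>(t, x). ?d t x)"
    by (simp add: case_prod_beta cbox_Pair_eq)
  from integral_swap_continuous[OF this]
  have "integral {0..T} (\<lambda>t. integral {a..b} (?d t)) =
        integral {a..b} (\<lambda>x. integral {0..T} (\<lambda>t. ?d t x))"
    by simp
  also have "\<dots> = integral {a..b} (\<lambda>x. F T x * f21 T x - F 0 x * f21 0 x)"
  proof (intro integral_cong integral_unique)
    fix x assume x: "x \<in> {a..b}"
    have Ft: "((\<lambda>s. F s x) has_vector_derivative integral {a..x} (f11t t)) (at t within {0..T})"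
      if t: "t \<in> {0..T}" for t
    proof -
      have "((\<lambda>s. integral (cbox a x) (f11 s)) has_vector_derivative integral (cbox a x) (f11t t))
          (at t within {0..T})"
      proof (rule leibniz_rule_vector_derivative)
        show "f11 s integrable_on cbox a x" if "s \<in> {0..T}" for s
          using x continuous_on_slice[OF cont(1) that]
          by (auto intro!: integrable_continuous_real elim!: continuous_on_subset)
        show "continuous_on ({0..T} \<times> cbox a x) (\<lambda>(t, x). f11t t x)"
          by (rule continuous_on_subset[OF cont(3)]) (use x in auto)
      qed (use x t f11t in auto)
      then show ?thesis by (simp add: F_def)
    qed
    show "((\<lambda>t. ?d t x) has_integral (F T x * f21 T x - F 0 x * f21 0 x)) {0..T}"
    proof (rule fundamental_theorem_of_calculus[OF T])
      fix t assume t: "t \<in> {0..T}"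
      show "((\<lambda>t. F t x * f21 t x) has_vector_derivative ?d t x) (at t within {0..T})"
        using has_vector_derivative_mult[OF Ft[OF t] f21t[OF t x]] by (simp add: add.commute)
    qed
  qed
  also have "\<dots> = integral {a..b} (\<lambda>x. F T x * f21 T x) - integral {a..b} (\<lambda>x. F 0 x * f21 0 x)"
  proof -
    have "continuous_on {a..b} (\<lambda>x. F t x * f21 t x)" if "t \<in> {0..T}" for t
      by (intro continuous_on_mult continuous_on_slice[OF cF that]
          continuous_on_slice[OF cont(2) that])
    with T show ?thesis
      by (intro Henstock_Kurzweil_Integration.integral_diff integrable_continuous_real) auto
  qed
  finally show ?thesis .
qed


section \<open>Integrals over intervals and the norms of the data\<close>

lemma integral_abs_nonneg: "0 \<le> integral A (\<lambda>x. \<bar>f x :: real\<bar>)"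
  by (cases "(\<lambda>x. \<bar>f x\<bar>) integrable_on A")
     (auto intro: Henstock_Kurzweil_Integration.integral_nonneg simp: not_integrable_integral)

lemma ennreal_integral_abs_eq_nn_integral:
  fixes g :: "real \<Rightarrow> real"
  assumes g: "continuous_on {a..b} g"
  shows "ennreal (integral {a..b} (\<lambda>x. \<bar>g x\<bar>)) = (\<integral>\<^sup>+x\<in>{a..b}. ennreal \<bar>g x\<bar> \<partial>lborel)"
proof -
  have i: "set_integrable lborel {a..b} (\<lambda>x. \<bar>g x\<bar>)"
    by (intro borel_integrable_atLeastAtMost' continuous_intros g)
  have "(\<integral>\<^sup>+x\<in>{a..b}. ennreal \<bar>g x\<bar> \<partial>lborel)
      = (\<integral>\<^sup>+x. ennreal (indicator {a..b} x *\<^sub>R \<bar>g x\<bar>) \<partial>lborel)"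
    by (rule nn_integral_cong) (simp split: split_indicator)
  also have "\<dots> = ennreal (LINT x:{a..b}|lborel. \<bar>g x\<bar>)"
    unfolding set_lebesgue_integral_def
    by (rule nn_integral_eq_integral) (use i in \<open>simp_all add: set_integrable_def\<close>)
  finally show ?thesis
    by (simp add: set_borel_integral_eq_integral(2)[OF i])
qed

lemma integral_abs_le_L1_norm:
  assumes g: "continuous_on {a..b} g"
  shows "ennreal (integral {a..b} (\<lambda>x. \<bar>g x\<bar>)) \<le> L1_norm g"
  unfolding ennreal_integral_abs_eq_nn_integral[OF g] L1_norm_def
  by (rule nn_integral_mono) (simp split: split_indicator)

lemma cont_strip_rectangle:
  assumes "cont_strip T f"
  shows "continuous_on ({0..T} \<times> {a..b}) (\<lambda>(t, x). f t x)"
  using assms unfolding cont_strip_def by (rule continuous_on_subset) auto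

lemma cont_strip_slice:
  assumes "cont_strip T f" "t \<in> {0..T}"
  shows "continuous_on A (f t)"
  by (rule continuous_on_subset[OF continuous_on_slice[OF assms[unfolded cont_strip_def]]]) simp

lemma cont_strip_add:
  "cont_strip T f \<Longrightarrow> cont_strip T g \<Longrightarrow> cont_strip T (\<lambda>t x. f t x + g t x)"
  unfolding cont_strip_def case_prod_beta by (intro continuous_intros)

lemma cont_strip_diff:
  "cont_strip T f \<Longrightarrow> cont_strip T g \<Longrightarrow> cont_strip T (\<lambda>t x. f t x - g t x)"
  unfolding cont_strip_def case_prod_beta by (intro continuous_intros)

lemma cont_strip_mult:
  "cont_strip T f \<Longrightarrow> cont_strip T g \<Longrightarrow> cont_strip T (\<lambda>t x. f t x * g t x)"
  unfolding cont_strip_def case_prod_beta by (intro continuous_intros)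

lemma cont_strip_abs:
  "cont_strip T f \<Longrightarrow> cont_strip T (\<lambda>t x. \<bar>f t x\<bar>)"
  unfolding cont_strip_def case_prod_beta by (intro continuous_intros)

lemma cont_strip_cong:
  "cont_strip T f \<Longrightarrow> (\<And>t x. t \<in> {0..T} \<Longrightarrow> f t x = g t x) \<Longrightarrow> cont_strip T g"
  unfolding cont_strip_def by (erule continuous_on_eq) auto

lemma continuous_on_rectangle_integral:
  fixes f :: "real \<Rightarrow> real \<Rightarrow> real"
  assumes "continuous_on ({0..T} \<times> {a..b}) (\<lambda>(t, x). f t x)"
  shows "continuous_on {0..T} (\<lambda>t. integral {a..b} (f t))"
  using integral_continuous_on_param[of "{0..T}" a b f] assms by simp

lemma integral_abs_rectangle_le_nn_integral:
  assumes g: "cont_strip T g"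
  shows "ennreal (integral {0..T} (\<lambda>t. integral {a..b} (\<lambda>x. \<bar>g t x\<bar>)))
       \<le> (\<integral>\<^sup>+t\<in>{0..T}. (\<integral>\<^sup>+x. ennreal \<bar>g t x\<bar> \<partial>lborel) \<partial>lborel)"
proof -
  let ?N = "\<lambda>t. integral {a..b} (\<lambda>x. \<bar>g t x\<bar>)"
  have N0: "0 \<le> ?N t" for t
    by (rule integral_abs_nonneg)
  have "ennreal (integral {0..T} (\<lambda>t. \<bar>?N t\<bar>)) = (\<integral>\<^sup>+t\<in>{0..T}. ennreal \<bar>?N t\<bar> \<partial>lborel)"
    by (intro ennreal_integral_abs_eq_nn_integral continuous_on_rectangle_integral
        cont_strip_rectangle cont_strip_abs g)
  also have "\<dots> \<le> (\<integral>\<^sup>+t\<in>{0..T}. (\<integral>\<^sup>+x. ennreal \<bar>g t x\<bar> \<partial>lborel) \<partial>lborel)"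
  proof (rule nn_integral_mono)
    fix t
    show "ennreal \<bar>?N t\<bar> * indicator {0..T} t
        \<le> (\<integral>\<^sup>+x. ennreal \<bar>g t x\<bar> \<partial>lborel) * indicator {0..T} t"
      using integral_abs_le_L1_norm[OF cont_strip_slice[OF g], of t a b] N0[of t]
      by (simp add: L1_norm_def split: split_indicator)
  qed
  finally show ?thesis using N0 by simp
qed

lemma abs_interaction_potential_le:
  fixes f g :: "real \<Rightarrow> real"
  assumes f: "continuous_on {a..b} f" and g: "continuous_on {a..b} g"
  shows "\<bar>integral {a..b} (\<lambda>x. integral {a..x} f * g x)\<bar>
       \<le> integral {a..b} (\<lambda>x. \<bar>f x\<bar>) * integral {a..b} (\<lambda>x. \<bar>g x\<bar>)"
proof -
  have "norm (integral {a..b} (\<lambda>x. integral {a..x} f * g x))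
      \<le> integral {a..b} (\<lambda>x. integral {a..b} (\<lambda>x. \<bar>f x\<bar>) * \<bar>g x\<bar>)"
  proof (rule integral_norm_bound_integral)
    show "norm (integral {a..x} f * g x) \<le> integral {a..b} (\<lambda>x. \<bar>f x\<bar>) * \<bar>g x\<bar>"
      if "x \<in> {a..b}" for x
      using abs_indefinite_integral_le[OF f that] by (simp add: abs_mult mult_right_mono)
  qed (intro integrable_continuous_real continuous_intros f g continuous_on_indefinite_integral)+
  then show ?thesis by simp
qed

section \<open>The estimate on a rectangle\<close>

text \<open>
  Both halves of the balance law combined. On the right-hand side \<open>A0 * B0\<close> and \<open>A * B\<close> bound
  the functional at the times \<open>0\<close> and \<open>T\<close>, and the next two products the sources. All bounds are on integrals over the rectangle alone,
  and \<open>\<epsilon>\<close> measures the fluxes through its two lateral sides: these are the only trace that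
  the truncation to \<open>{a..b}\<close> leaves in the estimate.
\<close>

lemma interaction_estimate_rectangle:
  assumes T: "0 \<le> T" and ab: "a \<le> b"
    and reg: "C1_in_t T f11" "C1_in_x T f12" "C1_in_t T f21" "C1_in_x T f22"
    and eq1: "\<And>t x. t \<in> {0..T} \<Longrightarrow> pd_t T f11 t x + pd_x f12 t x = G1 t x"
    and eq2: "\<And>t x. t \<in> {0..T} \<Longrightarrow> pd_t T f21 t x - pd_x f22 t x = G2 t x"
    and A0: "integral {a..b} (\<lambda>x. \<bar>f11 0 x\<bar>) \<le> A0"
    and B0: "integral {a..b} (\<lambda>x. \<bar>f21 0 x\<bar>) \<le> B0"
    and A: "\<And>t. t \<in> {0..T} \<Longrightarrow> integral {a..b} (\<lambda>x. \<bar>f11 t x\<bar>) \<le> A"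
    and B: "\<And>t. t \<in> {0..T} \<Longrightarrow> integral {a..b} (\<lambda>x. \<bar>f21 t x\<bar>) \<le> B"
    and A1: "integral {0..T} (\<lambda>t. integral {a..b} (\<lambda>x. \<bar>G1 t x\<bar>)) \<le> A1"
    and B1: "integral {0..T} (\<lambda>t. integral {a..b} (\<lambda>x. \<bar>G2 t x\<bar>)) \<le> B1"
    and eps: "\<And>t. t \<in> {0..T} \<Longrightarrow> \<bar>f12 t a\<bar> \<le> \<epsilon>" "\<And>t. t \<in> {0..T} \<Longrightarrow> \<bar>f22 t b\<bar> \<le> \<epsilon>"
  shows "integral {0..T} (\<lambda>t. integral {a..b} (\<lambda>x. f11 t x * f22 t x + f12 t x * f21 t x))
       \<le> A0 * B0 + A * B + A1 * B + A * B1 + T * (\<epsilon> * (A + B))"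
proof -
  let ?h = "\<lambda>t x. f11 t x * f22 t x + f12 t x * f21 t x"
  let ?I = "\<lambda>t. integral {a..b} (\<lambda>x. integral {a..x} (f11 t) * f21 t x)"
  let ?d = "\<lambda>t x. integral {a..x} (pd_t T f11 t) * f21 t x + integral {a..x} (f11 t) * pd_t T f21 t x"
  let ?N = "\<lambda>(f :: real \<Rightarrow> real \<Rightarrow> real) (t :: real). integral {a..b} (\<lambda>x. \<bar>f t x\<bar>)"
  have cs: "cont_strip T f11" "cont_strip T (pd_t T f11)" "cont_strip T f21" "cont_strip T (pd_t T f21)"
    "cont_strip T f12" "cont_strip T (pd_x f12)" "cont_strip T f22" "cont_strip T (pd_x f22)"
    using reg by (auto simp: C1_in_t_def C1_in_x_def)
  have csG: "cont_strip T G1" "cont_strip T G2"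
    using cont_strip_cong[OF cont_strip_add[OF cs(2,6)] eq1]
      cont_strip_cong[OF cont_strip_diff[OF cs(4,8)] eq2] by blast+
  have dt: "((\<lambda>s. f s x) has_vector_derivative pd_t T f t x) (at t within {0..T})"
    if "C1_in_t T f" "t \<in> {0..T}" for f t x
    using that unfolding C1_in_t_def pd_t_def by (auto simp flip: vector_derivative_works)
  have dx: "(f t has_real_derivative pd_x f t x) (at x)"
    if "C1_in_x T f" "t \<in> {0..T}" for f t x
    using that unfolding C1_in_x_def pd_x_def by (auto simp: DERIV_deriv_iff_real_differentiable)
  have N0: "0 \<le> ?N f t" for f t
    by (rule integral_abs_nonneg)
  have T0: "0 \<in> {0..T}" "T \<in> {0..T}" using T by auto
  have A_nonneg: "0 \<le> A" and B_nonneg: "0 \<le> B"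
    using A[OF T0(1)] B[OF T0(1)] N0[of f11 0] N0[of f21 0] by linarith+
  have eps0: "0 \<le> \<epsilon>" using eps(1)[OF T0(1)] by linarith

  have fixed_time: "integral {a..b} (?h t)
      \<le> ?N G1 t * B + A * ?N G2 t + \<epsilon> * (A + B) - integral {a..b} (?d t)"
    if t: "t \<in> {0..T}" for t
  proof -
    have "integral {a..b} (?h t) + integral {a..b} (?d t)
      \<le> ?N G1 t * ?N f21 t + ?N f11 t * ?N G2 t + \<bar>f12 t a\<bar> * ?N f21 t + ?N f11 t * \<bar>f22 t b\<bar>"
      by (rule interaction_estimate_fixed_time[OF ab _ _ _ _ _ _ dx[OF reg(2) t] dx[OF reg(4) t]
            eq1[OF t] eq2[OF t]])
         (rule cont_strip_slice[OF _ t], fact cs csG)+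
    also have "\<dots> \<le> ?N G1 t * B + A * ?N G2 t + \<epsilon> * B + A * \<epsilon>"
      by (intro add_mono mult_mono A B eps t N0 A_nonneg B_nonneg eps0 order_refl) auto
    finally show ?thesis by (simp add: algebra_simps)
  qed
  have cN: "continuous_on {0..T} (?N G1)" "continuous_on {0..T} (?N G2)"
    by (intro continuous_on_rectangle_integral cont_strip_rectangle cont_strip_abs csG)+
  have ch: "continuous_on {0..T} (\<lambda>t. integral {a..b} (?h t))"
    by (intro continuous_on_rectangle_integral cont_strip_rectangle cont_strip_add cont_strip_mult cs)
  have cd: "continuous_on {0..T} (\<lambda>t. integral {a..b} (?d t))"
  proof (rule continuous_on_rectangle_integral)
    note c = continuous_on_indefinite_integral_param[OF cont_strip_rectangle[OF cs(1), of a b]]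
      continuous_on_indefinite_integral_param[OF cont_strip_rectangle[OF cs(2), of a b]]
      cont_strip_rectangle[OF cs(3), of a b] cont_strip_rectangle[OF cs(4), of a b]
    show "continuous_on ({0..T} \<times> {a..b}) (\<lambda>(t, x). ?d t x)"
      using c unfolding case_prod_beta by (intro continuous_on_add continuous_on_mult)
  qed
  have "integral {0..T} (\<lambda>t. integral {a..b} (?h t))
     \<le> integral {0..T} (\<lambda>t. ?N G1 t * B + A * ?N G2 t + \<epsilon> * (A + B) - integral {a..b} (?d t))"
    by (intro integral_le integrable_continuous_real continuous_intros ch cd cN fixed_time)
  also have "\<dots> = integral {0..T} (?N G1) * B + A * integral {0..T} (?N G2) + T * (\<epsilon> * (A + B))
      - integral {0..T} (\<lambda>t. integral {a..b} (?d t))"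
  proof -
    have i: "?N G1 integrable_on {0..T}" "?N G2 integrable_on {0..T}"
      "(\<lambda>t. integral {a..b} (?d t)) integrable_on {0..T}"
      by (intro integrable_continuous_real cN cd)+
    have "((\<lambda>t. \<epsilon> * (A + B)) has_integral T * (\<epsilon> * (A + B))) {0..T}"
      using has_integral_const_real[of "\<epsilon> * (A + B)" 0 T] T by simp
    with i show ?thesis
      by (intro integral_unique has_integral_diff has_integral_add has_integral_mult_left
          has_integral_mult_right integrable_integral)
  qed
  also have "integral {0..T} (\<lambda>t. integral {a..b} (?d t)) = ?I T - ?I 0"
    by (rule integral_time_derivative_of_interaction[OF T _ _ _ _ dt[OF reg(1)] dt[OF reg(3)]])
       (rule cont_strip_rectangle, fact cs)+
  also have "integral {0..T} (?N G1) * B + A * integral {0..T} (?N G2) + T * (\<epsilon> * (A + B)) - (?I T - ?I 0)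
     \<le> A1 * B + A * B1 + T * (\<epsilon> * (A + B)) + A * B + A0 * B0"
  proof -
    have I: "\<bar>?I t\<bar> \<le> ?N f11 t * ?N f21 t" if "t \<in> {0..T}" for t
      by (intro abs_interaction_potential_le cont_strip_slice[OF _ that] cs)
    have "?N f11 T * ?N f21 T \<le> A * B"
      by (intro mult_mono A B T0 N0 A_nonneg)
    moreover have "?N f11 0 * ?N f21 0 \<le> A0 * B0"
      using A0 B0 N0[of f11 0] by (intro mult_mono N0) auto
    moreover have "integral {0..T} (?N G1) * B \<le> A1 * B" "A * integral {0..T} (?N G2) \<le> A * B1"
      by (intro mult_right_mono mult_left_mono A1 B1 A_nonneg B_nonneg)+
    ultimately show ?thesis using I[OF T0(1)] I[OF T0(2)] by linarith
  qed
  finally show ?thesis by simp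
qed

section \<open>Integration over the strip\<close>

lemma vanishes_at_infinityE:
  assumes "vanishes_at_infinity T g" "0 < \<epsilon>"
  obtains R where "\<And>t x. t \<in> {0..T} \<Longrightarrow> R \<le> \<bar>x\<bar> \<Longrightarrow> \<bar>g t x\<bar> < \<epsilon>"
proof -
  have "\<forall>\<^sub>F x in at_infinity. \<forall>t\<in>{0..T}. dist (g t x) 0 < \<epsilon>"
    using assms by (intro uniform_limitD) (auto simp: vanishes_at_infinity_def)
  then obtain R where "\<forall>x. R \<le> \<bar>x\<bar> \<longrightarrow> (\<forall>t\<in>{0..T}. \<bar>g t x\<bar> < \<epsilon>)"
    by (auto simp: eventually_at_infinity)
  then show ?thesis by (intro that[of R]) auto
qed

lemma bounded_of_vanishes_at_infinity:
  assumes g: "cont_strip T g" "vanishes_at_infinity T g"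
  obtains M where "\<And>t x. t \<in> {0..T} \<Longrightarrow> \<bar>g t x\<bar> \<le> M"
proof -
  obtain R where R: "\<And>t x. t \<in> {0..T} \<Longrightarrow> R \<le> \<bar>x\<bar> \<Longrightarrow> \<bar>g t x\<bar> < 1"
    using vanishes_at_infinityE[OF g(2) zero_less_one] by blast
  have "bounded ((\<lambda>(t, x). g t x) ` ({0..T} \<times> {-R..R}))"
    by (intro compact_imp_bounded compact_continuous_image cont_strip_rectangle g compact_Times) auto
  then obtain M where M: "\<And>t x. t \<in> {0..T} \<Longrightarrow> x \<in> {-R..R} \<Longrightarrow> \<bar>g t x\<bar> \<le> M"
    unfolding bounded_iff by fastforce
  have "\<bar>g t x\<bar> \<le> max M 1" if "t \<in> {0..T}" for t x
    using R[OF that, of x] M[OF that, of x] by (cases "R \<le> \<bar>x\<bar>") (fastforce simp: abs_le_iff)+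
  then show ?thesis by (rule that)
qed

lemma cont_strip_set_borel_measurable:
  assumes "cont_strip T f"
  shows "set_borel_measurable lborel ({0..T} \<times> UNIV) (\<lambda>(t, x). f t x)"
proof -
  have "{0..T} \<times> (UNIV :: real set) \<in> sets borel"
    by (intro borel_closed closed_Times) auto
  from borel_measurable_continuous_on_indicator[OF this assms[unfolded cont_strip_def]]
  show ?thesis by (simp add: set_borel_measurable_def)
qed

text \<open>
  A product of an unknown that is integrable in space, uniformly in time, with one that is
  bounded. In the theorem these are a density and a flux: the flux is not controlled by the data,
  but it is continuous and decays uniformly, which makes it bounded.
\<close>

lemma set_integrable_strip_mult_bounded:
  assumes f: "cont_strip T f" and g: "cont_strip T g"
    and M: "\<And>t x. t \<in> {0..T} \<Longrightarrow> \<bar>g t x\<bar> \<le> M"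
    and K: "\<And>t. t \<in> {0..T} \<Longrightarrow> L1_norm (f t) \<le> K" "K < \<infinity>"
  shows "set_integrable lborel ({0..T} \<times> UNIV) (\<lambda>(t, x). f t x * g t x)"
proof -
  let ?S = "{0..T} \<times> (UNIV :: real set)"
  have meas: "(\<lambda>z. indicator ?S z *\<^sub>R f (fst z) (snd z)) \<in> borel_measurable (lborel \<Otimes>\<^sub>M lborel)"
    using cont_strip_set_borel_measurable[OF f]
    unfolding set_borel_measurable_def by (simp add: case_prod_beta lborel_prod)
  have "(\<integral>\<^sup>+z. ennreal \<bar>indicator ?S z *\<^sub>R f (fst z) (snd z)\<bar> \<partial>lborel)
      = (\<integral>\<^sup>+t. (\<integral>\<^sup>+x. ennreal \<bar>indicator ?S (t, x) *\<^sub>R f t x\<bar> \<partial>lborel) \<partial>lborel)"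
    using lborel.nn_integral_fst[of "\<lambda>z. ennreal \<bar>indicator ?S z *\<^sub>R f (fst z) (snd z)\<bar>" lborel] meas
    by (simp add: lborel_prod)
  also have "\<dots> \<le> (\<integral>\<^sup>+t. K * indicator {0..T} t \<partial>lborel)"
  proof (rule nn_integral_mono)
    fix t show "(\<integral>\<^sup>+x. ennreal \<bar>indicator ?S (t, x) *\<^sub>R f t x\<bar> \<partial>lborel) \<le> K * indicator {0..T} t"
      using K(1)[of t] by (cases "t \<in> {0..T}") (auto simp: L1_norm_def indicator_def)
  qed
  also have "\<dots> < \<infinity>"
    using K(2) by (simp add: nn_integral_cmult ennreal_mult_less_top emeasure_lborel_Icc_eq)
  finally have "integrable lborel (\<lambda>z. indicator ?S z *\<^sub>R f (fst z) (snd z))"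
    using meas by (intro integrableI_bounded) (simp_all add: lborel_prod)
  then have "integrable lborel (\<lambda>z. M * (indicator ?S z *\<^sub>R f (fst z) (snd z)))"
    by (rule integrable_mult_right)
  then show ?thesis
    unfolding set_integrable_def
  proof (rule Bochner_Integration.integrable_bound)
    show "(\<lambda>z. indicator ?S z *\<^sub>R (\<lambda>(t, x). f t x * g t x) z) \<in> borel_measurable lborel"
      using cont_strip_set_borel_measurable[OF cont_strip_mult[OF f g]]
      unfolding set_borel_measurable_def by simp
    show "AE z in lborel. norm (indicator ?S z *\<^sub>R (\<lambda>(t, x). f t x * g t x) z)
        \<le> norm (M * (indicator ?S z *\<^sub>R f (fst z) (snd z)))"
    proof (rule AE_I2)
      fix z :: "real \<times> real"
      have "\<bar>g (fst z) (snd z)\<bar> \<le> \<bar>M\<bar>" if "fst z \<in> {0..T}"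
        using M[OF that, of "snd z"] by linarith
      then show "norm (indicator ?S z *\<^sub>R (\<lambda>(t, x). f t x * g t x) z)
        \<le> norm (M * (indicator ?S z *\<^sub>R f (fst z) (snd z)))"
        by (cases z) (auto simp: abs_mult mult.commute[of "\<bar>M\<bar>"] mult_left_mono split: split_indicator)
    qed
  qed
qed

text \<open>
  Dominated convergence along growing rectangles, with Fubini's theorem on each side: it passes
  from the estimate on rectangles to the iterated Lebesgue integral over the strip.
\<close>

lemma tendsto_integral_strip:
  assumes h: "cont_strip T h"
    and int: "set_integrable lborel ({0..T} \<times> UNIV) (\<lambda>(t, x). h t x)"
  shows "(\<lambda>n. integral {0..T} (\<lambda>t. integral {-real n..real n} (h t)))
    \<longlonglongrightarrow> (LINT t:{0..T}|lborel. (LINT x|lborel. h t x))"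
proof -
  let ?h = "\<lambda>(t, x). h t x"
  let ?S = "{0..T} \<times> (UNIV :: real set)" and ?R = "\<lambda>n. {0..T} \<times> {-real n..real n}"
  have "(\<lambda>n. LINT z|lborel. indicator (?R n) z *\<^sub>R ?h z) \<longlonglongrightarrow> (LINT z|lborel. indicator ?S z *\<^sub>R ?h z)"
  proof (rule integral_dominated_convergence)
    show "integrable lborel (\<lambda>z. norm (indicator ?S z *\<^sub>R ?h z))"
      using int unfolding set_integrable_def by (rule integrable_norm)
    show "(\<lambda>z. indicator ?S z *\<^sub>R ?h z) \<in> borel_measurable lborel"
      using int unfolding set_integrable_def by (rule borel_measurable_integrable)
    show "(\<lambda>z. indicator (?R n) z *\<^sub>R ?h z) \<in> borel_measurable lborel" for n
    proof -
      have "?R n \<in> sets borel"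
        by (intro borel_closed closed_Times) auto
      from borel_measurable_continuous_on_indicator[OF this cont_strip_rectangle[OF h]]
      show ?thesis by simp
    qed
    show "AE z in lborel. (\<lambda>n. indicator (?R n) z *\<^sub>R ?h z) \<longlonglongrightarrow> indicator ?S z *\<^sub>R ?h z"
    proof (rule AE_I2)
      fix z :: "real \<times> real"
      obtain N :: nat where N: "\<bar>snd z\<bar> \<le> real N" using real_arch_simple by blast
      have "eventually (\<lambda>n. indicator ?S z *\<^sub>R ?h z = indicator (?R n) z *\<^sub>R ?h z) sequentially"
        using eventually_ge_at_top[of N]
      proof eventually_elim
        case (elim n)
        then have "\<bar>snd z\<bar> \<le> real n" using N by linarith
        then show ?case by (cases z) (auto split: split_indicator)
      qed
      then show "(\<lambda>n. indicator (?R n) z *\<^sub>R ?h z) \<longlonglongrightarrow> indicator ?S z *\<^sub>R ?h z"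
        by (rule Lim_transform_eventually[OF tendsto_const])
    qed
    show "AE z in lborel. norm (indicator (?R n) z *\<^sub>R ?h z) \<le> norm (indicator ?S z *\<^sub>R ?h z)" for n
      by (rule AE_I2) (auto split: split_indicator)
  qed
  moreover have "(LINT z|lborel. indicator (?R n) z *\<^sub>R ?h z)
      = integral {0..T} (\<lambda>t. integral {-real n..real n} (h t))" for n
  proof -
    have c: "continuous_on (cbox (0, -real n) (T, real n)) ?h"
      using cont_strip_rectangle[OF h] by (simp add: cbox_Pair_eq)
    have "set_integrable lborel (?R n) ?h"
      unfolding set_integrable_def
      by (intro borel_integrable_compact compact_Times cont_strip_rectangle h) auto
    from set_borel_integral_eq_integral(2)[OF this]
    have "(LINT z|lborel. indicator (?R n) z *\<^sub>R ?h z) = integral (cbox (0, -real n) (T, real n)) ?h"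
      by (simp add: set_lebesgue_integral_def cbox_Pair_eq)
    with integral_prod_continuous[OF c] show ?thesis by simp
  qed
  moreover have "(LINT z|lborel. indicator ?S z *\<^sub>R ?h z)
      = (LINT t:{0..T}|lborel. (LINT x|lborel. h t x))"
  proof -
    have "integrable (lborel \<Otimes>\<^sub>M lborel) (\<lambda>z. indicator ?S z *\<^sub>R ?h z)"
      using int unfolding set_integrable_def lborel_prod .
    from lborel_pair.integral_fst'[OF this]
    have "(LINT z|lborel. indicator ?S z *\<^sub>R ?h z)
        = (LINT t|lborel. (LINT x|lborel. indicator ?S (t, x) *\<^sub>R h t x))"
      by (simp add: lborel_prod)
    also have "\<dots> = (LINT t|lborel. indicator {0..T} t *\<^sub>R (LINT x|lborel. h t x))"
      by (rule Bochner_Integration.integral_cong) (auto split: split_indicator)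
    finally show ?thesis by (simp add: set_lebesgue_integral_def)
  qed
  ultimately show ?thesis by simp
qed

section \<open>Data of size zero\<close>

text \<open>
  In \<open>[0, \<infinity>]\<close> the product of zero and infinity is zero, so the product of the two data sizes may
  be finite although one factor is infinite. The other factor is then zero, and this kills the
  whole equation: by continuity the density and the source are zero everywhere, hence the flux
  is constant in space, and its decay makes it zero. The coefficient \<open>c\<close> is \<open>1\<close> for the first
  equation of the system and \<open>- 1\<close> for the second.
\<close>

lemma vanishes_of_data_size_zero:
  assumes T: "0 < T" and f: "C1_in_t T f" and g: "C1_in_x T g" "vanishes_at_infinity T g"
    and c: "c \<noteq> 0"
    and eq: "\<And>t x. t \<in> {0..T} \<Longrightarrow> pd_t T f t x + c * pd_x g t x = G t x"
    and zero: "data_size T f G = 0" and t: "t \<in> {0..T}"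
  shows "f t x = 0" "g t x = 0"
proof -
  have cs: "cont_strip T f" "cont_strip T (pd_t T f)" "cont_strip T (pd_x g)"
    using f g by (auto simp: C1_in_t_def C1_in_x_def)
  have "cont_strip T (\<lambda>t x. c)"
    by (simp add: cont_strip_def case_prod_beta)
  then have csG: "cont_strip T G"
    by (rule cont_strip_cong[OF cont_strip_add[OF cs(2) cont_strip_mult[OF _ cs(3)]] eq])
  have f0: "f s y = 0" if s: "s \<in> {0..T}" for s y
  proof -
    note c = cont_strip_slice[OF cs(1) s]
    have "L1_norm (f s) \<le> (SUP t\<in>{0..T}. L1_norm (f t))"
      using s by (rule SUP_upper)
    also have "\<dots> = 0" using zero by (simp add: data_size_def)
    finally have "ennreal (integral {y..y + 1} (\<lambda>x. \<bar>f s x\<bar>)) \<le> 0"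
      using integral_abs_le_L1_norm[OF c, of y "y + 1"] by (simp only: order_trans)
    then have "integral {y..y + 1} (\<lambda>x. \<bar>f s x\<bar>) = 0"
      using integral_abs_nonneg[of "{y..y + 1}" "f s"] by (simp add: ennreal_eq_0_iff)
    then show ?thesis
      using integral_eq_0_iff[of y "y + 1" "\<lambda>x. \<bar>f s x\<bar>"] c[THEN continuous_on_rabs] by auto
  qed
  then show "f t x = 0" using t .
  have G0: "G s y = 0" if s: "s \<in> {0..T}" for s y
  proof -
    let ?N = "\<lambda>t. integral {y..y + 1} (\<lambda>x. \<bar>G t x\<bar>)"
    have "ennreal (integral {0..T} ?N) \<le> 0"
      using integral_abs_rectangle_le_nn_integral[OF csG, of y "y + 1"] zero
      by (simp add: data_size_def)
    moreover have "0 \<le> integral {0..T} ?N"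
      using integral_abs_nonneg[of "{0..T}" ?N] integral_abs_nonneg[of _ "G _"] by simp
    ultimately have "integral {0..T} ?N = 0" by (simp add: ennreal_eq_0_iff)
    moreover have "continuous_on {0..T} ?N"
      by (intro continuous_on_rectangle_integral cont_strip_rectangle cont_strip_abs csG)
    ultimately have "?N s = 0"
      using integral_eq_0_iff[of 0 T ?N] T s by (simp add: integral_abs_nonneg)
    then show ?thesis
      using integral_eq_0_iff[of y "y + 1" "\<lambda>x. \<bar>G s x\<bar>"]
        cont_strip_slice[OF csG s, THEN continuous_on_rabs] by auto
  qed
  have "pd_t T f t y = 0" for y
  proof -
    have "((\<lambda>s. f s y) has_vector_derivative 0) (at t within {0..T})"
      by (rule has_vector_derivative_transform[OF t _ has_vector_derivative_const[of 0]]) (simp add: f0)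
    then show ?thesis
      unfolding pd_t_def using T t by (intro vector_derivative_within_cbox[of 0 T, simplified]) auto
  qed
  then have "pd_x g t y = 0" for y using eq[OF t, of y] G0[OF t, of y] c by simp
  then have "DERIV (g t) y :> 0" for y
    using g(1) t unfolding C1_in_x_def pd_x_def by (metis DERIV_deriv_iff_real_differentiable)
  then have const: "g t y = g t x" for y by (intro DERIV_isconst_all) blast
  show "g t x = 0"
  proof (rule ccontr)
    assume "g t x \<noteq> 0"
    then obtain R where "\<And>s y. s \<in> {0..T} \<Longrightarrow> R \<le> \<bar>y\<bar> \<Longrightarrow> \<bar>g s y\<bar> < \<bar>g t x\<bar>"
      using vanishes_at_infinityE[OF g(2), of "\<bar>g t x\<bar>"] by auto
    from this[OF t abs_ge_self] const[of R] show False by simp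
  qed
qed

section \<open>The bilinear estimate\<close>

lemma interaction_estimate_finite_size:
  assumes T: "T > 0"
    and reg: "C1_in_t T f11" "C1_in_x T f12" "C1_in_t T f21" "C1_in_x T f22"
    and eq1: "\<And>t x. t \<in> {0..T} \<Longrightarrow> pd_t T f11 t x + pd_x f12 t x = G1 t x"
    and eq2: "\<And>t x. t \<in> {0..T} \<Longrightarrow> pd_t T f21 t x - pd_x f22 t x = G2 t x"
    and van: "vanishes_at_infinity T f12" "vanishes_at_infinity T f22"
    and fin: "data_size T f11 G1 < \<infinity>" "data_size T f21 G2 < \<infinity>"
  shows "set_integrable lborel ({0..T} \<times> UNIV)
        (\<lambda>(t, x). f11 t x * f22 t x + f12 t x * f21 t x)" (is ?int)
    and "(LINT t:{0..T}|lborel. (LINT x|lborel. f11 t x * f22 t x + f12 t x * f21 t x))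
        \<le> enn2real (data_size T f11 G1) * enn2real (data_size T f21 G2)" (is "?L \<le> _")
proof -
  let ?h = "\<lambda>t x. f11 t x * f22 t x + f12 t x * f21 t x"
  let ?sup = "\<lambda>f. SUP t\<in>{0..T}. L1_norm (f t)"
  let ?src = "\<lambda>G. \<integral>\<^sup>+t\<in>{0..T}. (\<integral>\<^sup>+x. ennreal \<bar>G t x\<bar> \<partial>lborel) \<partial>lborel"
  have cs: "cont_strip T f11" "cont_strip T f12" "cont_strip T f21" "cont_strip T f22"
    "cont_strip T (pd_t T f11)" "cont_strip T (pd_x f12)"
    "cont_strip T (pd_t T f21)" "cont_strip T (pd_x f22)"
    using reg by (auto simp: C1_in_t_def C1_in_x_def)
  have csG: "cont_strip T G1" "cont_strip T G2"
    using cont_strip_cong[OF cont_strip_add[OF cs(5,6)] eq1]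
      cont_strip_cong[OF cont_strip_diff[OF cs(7,8)] eq2] by blast+
  have fin1: "L1_norm (f11 0) < \<infinity>" "?sup f11 < \<infinity>" "?src G1 < \<infinity>"
    and fin2: "L1_norm (f21 0) < \<infinity>" "?sup f21 < \<infinity>" "?src G2 < \<infinity>"
    using fin unfolding data_size_def by (simp_all add: ennreal_add_less_top)
  obtain M where M: "\<And>t x. t \<in> {0..T} \<Longrightarrow> \<bar>f22 t x\<bar> \<le> M"
    using bounded_of_vanishes_at_infinity[OF cs(4) van(2)] by blast
  obtain M' where M': "\<And>t x. t \<in> {0..T} \<Longrightarrow> \<bar>f12 t x\<bar> \<le> M'"
    using bounded_of_vanishes_at_infinity[OF cs(2) van(1)] by blast
  have "set_integrable lborel ({0..T} \<times> UNIV) (\<lambda>(t, x). f11 t x * f22 t x)"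
    by (rule set_integrable_strip_mult_bounded[OF cs(1,4) M _ fin1(2)]) (auto intro: SUP_upper)
  moreover have "set_integrable lborel ({0..T} \<times> UNIV) (\<lambda>(t, x). f21 t x * f12 t x)"
    by (rule set_integrable_strip_mult_bounded[OF cs(3,2) M' _ fin2(2)]) (auto intro: SUP_upper)
  ultimately have "set_integrable lborel ({0..T} \<times> UNIV)
      (\<lambda>z. (\<lambda>(t, x). f11 t x * f22 t x) z + (\<lambda>(t, x). f21 t x * f12 t x) z)"
    by (rule set_integral_add(1))
  then show int: ?int
    by (rule back_subst[where P = "set_integrable lborel ({0..T} \<times> UNIV)"])
       (auto simp: fun_eq_iff)

  \<comment> \<open>The six constituents of the two data sizes as real numbers: initial norm, supremum of the
  norms, and norm of the source.\<close>
  define A0 A A1 where "A0 = enn2real (L1_norm (f11 0))" and "A = enn2real (?sup f11)"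
    and "A1 = enn2real (?src G1)"
  define B0 B B1 where "B0 = enn2real (L1_norm (f21 0))" and "B = enn2real (?sup f21)"
    and "B1 = enn2real (?src G2)"
  note defs = A0_def A_def A1_def B0_def B_def B1_def
  have nonneg: "0 \<le> A0" "0 \<le> A" "0 \<le> A1" "0 \<le> B0" "0 \<le> B" "0 \<le> B1"
    by (simp_all add: defs)
  have sizes: "enn2real (data_size T f11 G1) = A0 + A + A1" "enn2real (data_size T f21 G2) = B0 + B + B1"
    using fin1 fin2 unfolding data_size_def defs by (simp_all add: enn2real_plus ennreal_add_less_top)
  have le_real: "x \<le> enn2real y" if "ennreal x \<le> y" "y < \<infinity>" for x y
    using that by (cases y) (auto simp: ennreal_le_iff2 max_def split: if_splits)
  have L1: "integral {a..b} (\<lambda>x. \<bar>f t x\<bar>) \<le> enn2real (?sup f)"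
    if "cont_strip T f" "t \<in> {0..T}" "?sup f < \<infinity>" for f t a b
  proof (rule le_real)
    have "ennreal (integral {a..b} (\<lambda>x. \<bar>f t x\<bar>)) \<le> L1_norm (f t)"
      by (intro integral_abs_le_L1_norm cont_strip_slice[OF that(1,2)])
    also have "\<dots> \<le> ?sup f" using that(2) by (rule SUP_upper)
    finally show "ennreal (integral {a..b} (\<lambda>x. \<bar>f t x\<bar>)) \<le> ?sup f" .
  qed fact

  \<comment> \<open>The fluxes are below \<open>\<epsilon>\<close> on the lateral sides of all sufficiently wide rectangles.\<close>
  have main: "?L \<le> A0 * B0 + A * B + A1 * B + A * B1 + T * (\<epsilon> * (A + B))" if \<epsilon>: "0 < \<epsilon>" for \<epsilon>
  proof (rule LIMSEQ_le_const2[OF tendsto_integral_strip[OF _ int]])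
    show "cont_strip T ?h" by (intro cont_strip_add cont_strip_mult cs)
    obtain R1 where R1: "\<And>t x. t \<in> {0..T} \<Longrightarrow> R1 \<le> \<bar>x\<bar> \<Longrightarrow> \<bar>f12 t x\<bar> < \<epsilon>"
      using vanishes_at_infinityE[OF van(1) \<epsilon>] by blast
    obtain R2 where R2: "\<And>t x. t \<in> {0..T} \<Longrightarrow> R2 \<le> \<bar>x\<bar> \<Longrightarrow> \<bar>f22 t x\<bar> < \<epsilon>"
      using vanishes_at_infinityE[OF van(2) \<epsilon>] by blast
    obtain N :: nat where N: "max R1 R2 \<le> real N" using real_arch_simple by blast
    have "integral {0..T} (\<lambda>t. integral {-real n..real n} (?h t))
       \<le> A0 * B0 + A * B + A1 * B + A * B1 + T * (\<epsilon> * (A + B))" if n: "N \<le> n" for n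
    proof (rule interaction_estimate_rectangle[OF _ _ reg eq1 eq2])
      have n': "R1 \<le> real n" "R2 \<le> real n" using N n by linarith+
      show "\<bar>f12 t (- real n)\<bar> \<le> \<epsilon>" "\<bar>f22 t (real n)\<bar> \<le> \<epsilon>" if "t \<in> {0..T}" for t
        using R1[OF that, of "- real n"] R2[OF that, of "real n"] n' by simp_all
      show "integral {-real n..real n} (\<lambda>x. \<bar>f11 0 x\<bar>) \<le> A0"
        "integral {-real n..real n} (\<lambda>x. \<bar>f21 0 x\<bar>) \<le> B0"
        unfolding defs using T fin1 fin2
        by (auto intro!: le_real integral_abs_le_L1_norm cont_strip_slice[OF cs(1)] cont_strip_slice[OF cs(3)])
      show "integral {-real n..real n} (\<lambda>x. \<bar>f11 t x\<bar>) \<le> A"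
        "integral {-real n..real n} (\<lambda>x. \<bar>f21 t x\<bar>) \<le> B" if "t \<in> {0..T}" for t
        unfolding defs using fin1 fin2 that by (auto intro!: L1 cs)
      show "integral {0..T} (\<lambda>t. integral {-real n..real n} (\<lambda>x. \<bar>G1 t x\<bar>)) \<le> A1"
        "integral {0..T} (\<lambda>t. integral {-real n..real n} (\<lambda>x. \<bar>G2 t x\<bar>)) \<le> B1"
        unfolding defs by (rule le_real[OF integral_abs_rectangle_le_nn_integral]; fact csG fin1 fin2)+
    qed (use T in auto)
    then show "\<exists>N. \<forall>n\<ge>N. integral {0..T} (\<lambda>t. integral {-real n..real n} (?h t))
       \<le> A0 * B0 + A * B + A1 * B + A * B1 + T * (\<epsilon> * (A + B))" by blast
  qed
  have "((\<lambda>\<epsilon>. A0 * B0 + A * B + A1 * B + A * B1 + T * (\<epsilon> * (A + B)))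
      \<longlongrightarrow> A0 * B0 + A * B + A1 * B + A * B1 + T * (0 * (A + B))) (at_right 0)"
    by (intro tendsto_intros)
  moreover have "\<forall>\<^sub>F \<epsilon> in at_right 0. ?L \<le> A0 * B0 + A * B + A1 * B + A * B1 + T * (\<epsilon> * (A + B))"
    using eventually_at_right_less[of 0] by eventually_elim (rule main)
  ultimately have "?L \<le> A0 * B0 + A * B + A1 * B + A * B1 + T * (0 * (A + B))"
    by (intro tendsto_lowerbound[where F = "at_right 0"]) auto
  also have "\<dots> \<le> (A0 + A + A1) * (B0 + B + B1)"
    using nonneg by (simp add: distrib_left distrib_right)
  finally show "?L \<le> enn2real (data_size T f11 G1) * enn2real (data_size T f21 G2)"
    unfolding sizes .
qed

theorem lemma4p2:
  "\<exists>C::real. C > 0 \<and>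
    (\<forall>(T::real) (f11::real \<Rightarrow> real \<Rightarrow> real) (f12::real \<Rightarrow> real \<Rightarrow> real)
       (f21::real \<Rightarrow> real \<Rightarrow> real) (f22::real \<Rightarrow> real \<Rightarrow> real)
       (G1::real \<Rightarrow> real \<Rightarrow> real) (G2::real \<Rightarrow> real \<Rightarrow> real).
      T > 0 \<longrightarrow>
      C1_in_t T f11 \<longrightarrow> C1_in_x T f12 \<longrightarrow> C1_in_t T f21 \<longrightarrow> C1_in_x T f22 \<longrightarrow>
      (\<forall>t\<in>{0..T}. \<forall>x. pd_t T f11 t x + pd_x f12 t x = G1 t x) \<longrightarrow>
      (\<forall>t\<in>{0..T}. \<forall>x. pd_t T f21 t x - pd_x f22 t x = G2 t x) \<longrightarrow>
      vanishes_at_infinity T f11 \<longrightarrow> vanishes_at_infinity T f12 \<longrightarrow>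
      vanishes_at_infinity T f21 \<longrightarrow> vanishes_at_infinity T f22 \<longrightarrow>
      ennreal C * data_size T f11 G1 * data_size T f21 G2 < \<infinity> \<longrightarrow>
      set_integrable lborel ({0..T} \<times> UNIV)
        (\<lambda>(t, x). f11 t x * f22 t x + f12 t x * f21 t x) \<and>
      (LINT t:{0..T}|lborel. (LINT x|lborel. f11 t x * f22 t x + f12 t x * f21 t x))
        \<le> enn2real (ennreal C * data_size T f11 G1 * data_size T f21 G2))"
proof (intro exI[of _ 1] conjI allI impI)
  show "(1 :: real) > 0" by simp
next
  fix T :: real and f11 f12 f21 f22 G1 G2 :: "real \<Rightarrow> real \<Rightarrow> real"
  assume T: "T > 0"
    and reg: "C1_in_t T f11" "C1_in_x T f12" "C1_in_t T f21" "C1_in_x T f22"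
    and eq1: "\<forall>t\<in>{0..T}. \<forall>x. pd_t T f11 t x + pd_x f12 t x = G1 t x"
    and eq2: "\<forall>t\<in>{0..T}. \<forall>x. pd_t T f21 t x - pd_x f22 t x = G2 t x"
    and van: "vanishes_at_infinity T f12" "vanishes_at_infinity T f22"
    and fin: "ennreal 1 * data_size T f11 G1 * data_size T f21 G2 < \<infinity>"
  have "set_integrable lborel ({0..T} \<times> UNIV)
        (\<lambda>(t, x). f11 t x * f22 t x + f12 t x * f21 t x) \<and>
      (LINT t:{0..T}|lborel. (LINT x|lborel. f11 t x * f22 t x + f12 t x * f21 t x))
        \<le> enn2real (ennreal 1 * data_size T f11 G1 * data_size T f21 G2)"
  proof (cases "data_size T f11 G1 = 0 \<or> data_size T f21 G2 = 0")
    case True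
    then have "f11 t x * f22 t x + f12 t x * f21 t x = 0" if "t \<in> {0..T}" for t x
    proof
      assume "data_size T f11 G1 = 0"
      then have "f11 t x = 0" "f12 t x = 0"
        using vanishes_of_data_size_zero[OF T reg(1,2) van(1), of 1 G1 t x] eq1 that by simp_all
      then show ?thesis by simp
    next
      assume "data_size T f21 G2 = 0"
      then have "f21 t x = 0" "f22 t x = 0"
        using vanishes_of_data_size_zero[OF T reg(3,4) van(2), of "-1" G2 t x] eq2 that by simp_all
      then show ?thesis by simp
    qed
    then have "indicator ({0..T} \<times> UNIV) z *\<^sub>R (\<lambda>(t, x). f11 t x * f22 t x + f12 t x * f21 t x) z = 0"
      and "indicator {0..T} t *\<^sub>R (LINT x|lborel. f11 t x * f22 t x + f12 t x * f21 t x) = 0" for z t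
      by (auto split: split_indicator)
    then show ?thesis
      unfolding set_integrable_def set_lebesgue_integral_def
      by (simp del: scaleR_eq_0_iff real_scaleR_def)
  next
    case False
    then have "data_size T f11 G1 < \<infinity>" "data_size T f21 G2 < \<infinity>"
      using fin by (auto simp: ennreal_mult_less_top)
    with interaction_estimate_finite_size[OF T reg _ _ van this] eq1 eq2 show ?thesis
      by (simp add: enn2real_mult)
  qed
  then show "set_integrable lborel ({0..T} \<times> UNIV)
        (\<lambda>(t, x). f11 t x * f22 t x + f12 t x * f21 t x)"
    and "(LINT t:{0..T}|lborel. (LINT x|lborel. f11 t x * f22 t x + f12 t x * f21 t x))
        \<le> enn2real (ennreal 1 * data_size T f11 G1 * data_size T f21 G2)" by auto
qed

end
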